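(* Let $\mathcal{L} \subset \mathbb{P}^{2}_{\mathbb{C}}$ be an arrangement of $d\geq 6$ lines such that $m(\mathcal{L})=4$. Then $$n_{3}+3n_{4} \leq \frac{4d(d-3)}{15}.$$
   Context: We work over $\mathbb{C}$. An arrangement of $d$ lines $\mathcal{L}\subset\mathbb{P}^2$ is a set of $d$ distinct lines. For $r\ge 2$, $n_r$ denotes the number of points of $\mathbb{P}^2$ lying on exactly $r$ lines of $\mathcal{L}$, and the maximal multiplicity is $m(\mathcal{L})=\max\{r: n_r\neq 0\}$. *)

theory Defs
  imports "HOL-Analysis.Analysis"
begin

text \<open>
  The complex projective plane is modelled as the projectivisation of \<open>complex ^ 3\<close>: points are
  the one-dimensional and lines the two-dimensional complex linear subspaces, and a point lies on
  a line iff it is contained in it as a subspace. The prefix \<open>vec\<close> selects linear algebra over the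
  scalar field of the vectors (here the complex numbers) rather than over the reals.
\<close>

definition proj_points :: "(complex ^ 3) set set" where
  "proj_points = {p. vec.subspace p \<and> vec.dim p = 1}"

definition proj_lines :: "(complex ^ 3) set set" where
  "proj_lines = {l. vec.subspace l \<and> vec.dim l = 2}"

definition line_arrangement :: "nat \<Rightarrow> (complex ^ 3) set set \<Rightarrow> bool" where
  "line_arrangement d L \<longleftrightarrow> L \<subseteq> proj_lines \<and> finite L \<and> card L = d"

definition point_mult :: "(complex ^ 3) set set \<Rightarrow> (complex ^ 3) set \<Rightarrow> nat" where
  "point_mult L p = card {l \<in> L. p \<subseteq> l}"

text \<open>
  For a finite arrangement and \<open>r \<ge> 2\<close> the set of points counted here is finite, so \<open>card\<close> is
  the true count; the values at \<open>r < 2\<close> carry no meaning and are excluded from \<open>max_mult\<close>.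
\<close>

definition n_mult :: "(complex ^ 3) set set \<Rightarrow> nat \<Rightarrow> nat" where
  "n_mult L r = card {p \<in> proj_points. point_mult L p = r}"

definition max_mult :: "(complex ^ 3) set set \<Rightarrow> nat" where
  "max_mult L = Max {r. r \<ge> 2 \<and> n_mult L r \<noteq> 0}"

end

theory Submission
  imports Defs
begin

text \<open>
  Dualise: the \<open>d\<close> lines become \<open>d\<close> vectors \<open>v\<^sub>i\<close> of \<open>complex ^ 3\<close>, and a point of multiplicity \<open>r\<close> becomes
  a plane through the origin containing \<open>r\<close> of them. No five lines are concurrent, so as
  \<open>d \<ge> 6\<close> no plane contains more than two thirds of the vectors. This is a semistability condition, and
  it allows the configuration to be balanced: after a suitable linear change of coordinates the unit vectors
  \<open>u\<^sub>i\<close> in the directions of the \<open>v\<^sub>i\<close> are nearly a tight frame, that is, \<open>\<Sum>\<^sub>i u\<^sub>i u\<^sub>i\<^sup>*\<close> is nearly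
  \<open>d / 3\<close> times the identity. Taking the squared Frobenius norm gives
  \<open>\<Sum>\<^sub>i\<^sub>j |\<langle>u\<^sub>i, u\<^sub>j\<rangle>|\<^sup>2 \<approx> d\<^sup>2 / 3\<close>.
  
  On the other hand the \<open>r\<close> unit vectors of a multiple point lie in a plane, and there the Welch bound
  says that \<open>|\<langle>u\<^sub>i, u\<^sub>j\<rangle>|\<^sup>2\<close> sums to at least \<open>r\<^sup>2 / 2\<close> over all pairs, hence to at least \<open>r\<^sup>2 / 2 - r\<close> over
  the pairs of distinct indices. Two lines meet in only one point, so these contributions of different points
  are disjoint; together with the diagonal they give \<open>d + \<Sum>\<^sub>p (r\<^sub>p\<^sup>2 / 2 - r\<^sub>p) \<le> d\<^sup>2 / 3\<close>, where \<open>p\<close> runs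
  over the multiple points. Keeping only the points of multiplicity three and four,
  \<open>3/2 n\<^sub>3 + 4 n\<^sub>4 \<le> d (d - 3) / 3\<close>, which implies the claim.
  Summed over all multiple points, and combined with the count \<open>\<Sum>\<^sub>p r\<^sub>p (r\<^sub>p - 1) = d (d - 1)\<close> of pairs of
  lines, the inequality becomes Bojanowski's \<open>\<Sum>\<^sub>p r\<^sub>p (4 - r\<^sub>p) \<ge> 4 d\<close>, a refinement of Hirzebruch's inequality.
  
  The coordinates are found by minimising a Kempf-Ness energy over invertible matrices.
  Semistability bounds the energy from below (\<open>semistable_log_det_bound\<close>); a small
  perturbation makes the infimum attained (\<open>kn_energy_has_minimum\<close>), and the stationarity condition is the
  nearly tight frame property, needed only through the upper bound in \<open>kn_minimum_frame_bound\<close>. The upper and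
  lower estimates meet in \<open>semistable_incidence_bound\<close>.
\<close>

section \<open>Rank-one Hermitian matrices and the Welch bound\<close>

definition herm :: "complex ^ 'n \<Rightarrow> complex ^ 'n \<Rightarrow> complex" where
  "herm u w = (\<Sum>k\<in>UNIV. u $ k * cnj (w $ k))"

text \<open>
  The rank-one Hermitian matrix \<open>u u\<^sup>*\<close>. Matrices carry the real inner product \<open>Re tr (A B\<^sup>*)\<close>,
  whose norm is the Frobenius norm; it turns traces and sums of squared moduli into inner
  products with matrices of this shape.
\<close>

definition outer :: "complex ^ 'n \<Rightarrow> complex ^ 'n ^ 'n" where
  "outer u = (\<chi> k l. u $ k * cnj (u $ l))"

lemma inner_complex_eq_Re: "inner (a::complex) b = Re (a * cnj b)"
  by (simp add: inner_complex_def)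

lemma inner_outer: "inner S (outer w) = inner (S *v w) w"
proof -
  have "inner (S *v w) w = (\<Sum>k\<in>UNIV. \<Sum>l\<in>UNIV. inner (S $ k $ l * w $ l) (w $ k))"
    by (simp add: inner_vec_def matrix_vector_mult_def inner_sum_left)
  also have "\<dots> = inner S (outer w)"
    by (simp add: inner_vec_def outer_def inner_complex_eq_Re algebra_simps)
  finally show ?thesis by simp
qed

lemma outer_mult_vec: "outer u *v w = herm w u *s u"
  by (simp add: vec_eq_iff outer_def herm_def matrix_vector_mult_def sum_distrib_left sum_distrib_right algebra_simps)

lemma inner_outer_outer: "inner (outer u) (outer w) = (cmod (herm u w))\<^sup>2"
proof -
  have "inner (herm w u *s u) w = Re (herm w u * herm u w)"
    by (simp add: inner_vec_def herm_def[of u w] inner_complex_eq_Re sum_distrib_left mult.assoc)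
  moreover have "herm w u = cnj (herm u w)"
    by (simp add: herm_def mult.commute)
  moreover have "Re (cnj (herm u w) * herm u w) = (cmod (herm u w))\<^sup>2"
    by (metis mult.commute complex_norm_square Re_complex_of_real)
  ultimately show ?thesis by (simp add: inner_outer outer_mult_vec)
qed

lemma inner_outer_mat_1: "inner (outer u) (mat 1) = (norm u)\<^sup>2"
proof -
  have "inner (outer u) (mat 1) = inner (mat 1) (outer u)" by (rule inner_commute)
  then show ?thesis by (simp add: inner_outer power2_norm_eq_inner)
qed

lemma herm_self: "herm u u = (norm u)\<^sup>2"
  unfolding norm_vec_def herm_def L2_set_def
  by (simp add: sum_nonneg complex_norm_square flip: of_real_power)

text \<open>
  The matrix \<open>S = \<Sum>\<^sub>i u\<^sub>i u\<^sub>i\<^sup>*\<close> acts on the plane orthogonal to the conjugate of \<open>n\<close>. If \<open>P\<close> is the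
  orthogonal projection onto that plane, then \<open>\<langle>S, P\<rangle> = tr S = |C|\<close> and \<open>|P|\<^sup>2 = 2\<close>, so the bound is the
  Cauchy-Schwarz inequality for \<open>S\<close> and \<open>P\<close>, the sum on the right being \<open>|S|\<^sup>2\<close>. The factor
  \<open>1 / 2\<close>, instead of the \<open>1 / 3\<close> valid for arbitrary vectors of \<open>complex ^ 3\<close>, is what makes
  points of high multiplicity expensive.
\<close>

lemma welch_bound_in_plane:
  fixes u :: "'i \<Rightarrow> complex ^ 3" and n :: "complex ^ 3"
  assumes "n \<noteq> 0" and perp: "\<And>i. i \<in> C \<Longrightarrow> scalar_product (u i) n = 0"
    and unit: "\<And>i. i \<in> C \<Longrightarrow> norm (u i) = 1"
  shows "(real (card C))\<^sup>2 / 2 \<le> (\<Sum>i\<in>C. \<Sum>j\<in>C. (cmod (herm (u i) (u j)))\<^sup>2)"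
proof -
  \<comment> \<open>The pairing with \<open>n\<close> is bilinear; conjugating \<open>n\<close> turns it into Hermitian orthogonality.\<close>
  define m :: "complex ^ 3" where "m = (\<chi> k. cnj (n $ k))"
  have "m \<noteq> 0" using \<open>n \<noteq> 0\<close> by (auto simp: m_def vec_eq_iff)
  define S where "S = (\<Sum>i\<in>C. outer (u i))"
  define P where "P = mat 1 - (1 / (norm m)\<^sup>2) *\<^sub>R outer m"
  have um: "herm (u i) m = 0" if "i \<in> C" for i
    using perp[OF that] by (simp add: herm_def m_def scalar_product_def)
  have one: "inner (mat 1 :: complex^3^3) (mat 1) = 3"
  proof -
    have "inner ((mat 1 :: complex^3^3) $ k $ l) (mat 1 $ k $ l) = (if l = k then 1 else 0)" for k l
      by (simp add: mat_def)
    then show ?thesis by (simp add: inner_vec_def)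
  qed
  have "inner (outer m) (outer m) = (norm m)\<^sup>2 * (norm m)\<^sup>2"
    by (simp add: inner_outer_outer herm_self norm_mult power2_eq_square)
  moreover have "inner (mat 1) (outer m) = (norm m)\<^sup>2"
    by (simp add: inner_outer power2_norm_eq_inner)
  ultimately have PP: "inner P P = 2"
    using \<open>m \<noteq> 0\<close> unfolding P_def
    by (simp add: inner_diff_left inner_diff_right inner_outer_mat_1 one divide_simps flip: power_add)
  have "inner (outer (u i)) P = 1" if "i \<in> C" for i
    using um[OF that] unit[OF that]
    by (simp add: P_def inner_diff_right inner_outer_mat_1 inner_outer_outer)
  then have SP: "inner S P = card C"
    by (simp add: S_def inner_sum_left)
  have "inner S S = (\<Sum>i\<in>C. \<Sum>j\<in>C. (cmod (herm (u i) (u j)))\<^sup>2)"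
    unfolding S_def inner_sum_left inner_sum_right inner_outer_outer by (rule sum.swap)
  then show ?thesis
    using Cauchy_Schwarz_ineq[of S P] by (simp add: SP PP)
qed

section \<open>Triples of vectors and determinants\<close>

text \<open>
  The cross product, taken over the complex numbers without conjugation.
\<close>

definition ccross :: "complex ^ 3 \<Rightarrow> complex ^ 3 \<Rightarrow> complex ^ 3" where
  "ccross v w = vector [v $ 2 * w $ 3 - v $ 3 * w $ 2,
                        v $ 3 * w $ 1 - v $ 1 * w $ 3,
                        v $ 1 * w $ 2 - v $ 2 * w $ 1]"

lemma ccross_nonzero:
  assumes "w \<noteq> 0" and "\<And>c. v \<noteq> c *s w"
  shows "ccross v w \<noteq> 0"
proof
  assume "ccross v w = 0"
  then have "v $ 2 * w $ 3 = v $ 3 * w $ 2 \<and> v $ 3 * w $ 1 = v $ 1 * w $ 3 \<and> v $ 1 * w $ 2 = v $ 2 * w $ 1"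
    by (simp add: ccross_def vec_eq_iff forall_3 vector_3)
  moreover obtain k where "w $ k \<noteq> 0" using \<open>w \<noteq> 0\<close> by (auto simp: vec_eq_iff)
  ultimately have "v = (v $ k / w $ k) *s w"
    using exhaust_3[of k] by (auto simp: vec_eq_iff forall_3 field_simps)
  then show False using assms(2) by blast
qed

lemma det_rows_eq_ccross: "det (vector [a, b, c] :: complex ^ 3 ^ 3) = scalar_product c (ccross a b)"
  by (simp add: det_3 scalar_product_def sum_3 ccross_def vector_3 algebra_simps)

lemma scalar_product_ccross [simp]:
  "scalar_product a (ccross a b) = 0" "scalar_product b (ccross a b) = 0"
  by (simp_all add: scalar_product_def sum_3 ccross_def vector_3 algebra_simps)

lemma norm_det_rows_le:
  fixes a b c :: "complex ^ 3"
  shows "cmod (det (vector [a, b, c] :: complex ^ 3 ^ 3)) \<le> 6 * (norm a * norm b * norm c)"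
proof -
  have e: "cmod (a $ i * b $ j * c $ k) \<le> norm a * norm b * norm c" for i j k
    by (simp add: norm_mult) (intro mult_mono Finite_Cartesian_Product.norm_nth_le; simp)
  have tri: "cmod (p + q + r - x - y - z) \<le> cmod p + cmod q + cmod r + cmod x + cmod y + cmod z"
    for p q r x y z :: complex
    using norm_triangle_ineq[of p q] norm_triangle_ineq[of "p + q" r]
      norm_triangle_ineq4[of "p + q + r" x] norm_triangle_ineq4[of "p + q + r - x" y]
      norm_triangle_ineq4[of "p + q + r - x - y" z] by linarith
  let ?t = "\<lambda>i j k. a $ i * b $ j * c $ k"
  have "cmod (det (vector [a, b, c] :: complex ^ 3 ^ 3))
      = cmod (?t 1 2 3 + ?t 2 3 1 + ?t 3 1 2 - ?t 1 3 2 - ?t 2 1 3 - ?t 3 2 1)"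
    by (simp add: det_3 vector_3)
  also have "\<dots> \<le> cmod (?t 1 2 3) + cmod (?t 2 3 1) + cmod (?t 3 1 2)
      + cmod (?t 1 3 2) + cmod (?t 2 1 3) + cmod (?t 3 2 1)"
    by (rule tri)
  also have "\<dots> \<le> 6 * (norm a * norm b * norm c)"
    using e[of 1 2 3] e[of 2 3 1] e[of 3 1 2] e[of 1 3 2] e[of 2 1 3] e[of 3 2 1] by linarith
  finally show ?thesis .
qed

lemma det_rows_image:
  fixes g :: "complex ^ 3 ^ 3"
  shows "det (vector [g *v a, g *v b, g *v c] :: complex ^ 3 ^ 3)
       = det g * det (vector [a, b, c] :: complex ^ 3 ^ 3)"
proof -
  have "(vector [g *v a, g *v b, g *v c] :: complex ^ 3 ^ 3) = vector [a, b, c] ** transpose g"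
    by (simp add: vec_eq_iff forall_3 vector_3 matrix_vector_mult_def matrix_matrix_mult_def
        transpose_def sum_3 mult.commute)
  then show ?thesis by (simp add: det_mul)
qed

section \<open>Semistable configurations\<close>

text \<open>
  The vectors are read as points of the projective plane: they are pairwise distinct, and no line
  \<open>n\<close> contains more than two thirds of them. For distinct points, at least three in number, this is
  semistability in the sense of geometric invariant theory under the action of \<open>SL(3)\<close>.
\<close>

definition semistable :: "'i set \<Rightarrow> ('i \<Rightarrow> complex ^ 3) \<Rightarrow> bool" where
  "semistable I v \<longleftrightarrow> finite I \<and> 3 \<le> card I \<and>
     (\<forall>i\<in>I. \<forall>j\<in>I. \<forall>c. i \<noteq> j \<longrightarrow> v i \<noteq> c *s v j) \<and>
     (\<forall>n. n \<noteq> 0 \<longrightarrow> 3 * card {i \<in> I. scalar_product (v i) n = 0} \<le> 2 * card I)"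

lemma semistable_nonzero:
  assumes "semistable I v" "i \<in> I"
  shows "v i \<noteq> 0"
proof -
  have "I - {i} \<noteq> {}"
    using assms card_mono[of "{i}" I] by (auto simp: semistable_def)
  then obtain j where "j \<in> I" "j \<noteq> i" by auto
  then have "v i \<noteq> 0 *s v j" using assms by (metis semistable_def)
  then show ?thesis by simp
qed

lemma ex_min_on:
  fixes a :: "'i \<Rightarrow> real"
  assumes "finite X" "X \<noteq> {}"
  obtains x where "x \<in> X" "\<And>y. y \<in> X \<Longrightarrow> a x \<le> a y"
  using ex_is_arg_min_if_finite[OF assms, of a] by (auto simp: is_arg_min_linorder)

text \<open>
  The greedy basis for the weight \<open>a\<close>: \<open>i\<close> has least weight, \<open>j\<close> least weight among the other indices,
  and \<open>k\<close> least weight among the vectors off the line \<open>n\<close> through \<open>v\<^sub>i\<close> and \<open>v\<^sub>j\<close>. Besides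
  \<open>v\<^sub>i\<close> that line contains \<open>m\<close> of the vectors, all of weight at least \<open>a\<^sub>j\<close>, while the vectors off the line
  have weight at least \<open>a\<^sub>k\<close>. Hence the total weight is at least \<open>a\<^sub>i + m a\<^sub>j + (d - 1 - m) a\<^sub>k\<close>,
  and semistability, in the form \<open>3 (m + 1) \<le> 2 d\<close>, makes this at least \<open>d / 3\<close> times
  \<open>a\<^sub>i + a\<^sub>j + a\<^sub>k\<close>.
\<close>

lemma semistable_greedy_basis:
  fixes a :: "'i \<Rightarrow> real"
  assumes st: "semistable I v"
  obtains i j k where "i \<in> I" "j \<in> I" "k \<in> I"
    "det (vector [v i, v j, v k] :: complex ^ 3 ^ 3) \<noteq> 0"
    "card I * (a i + a j + a k) \<le> 3 * (\<Sum>l\<in>I. a l)"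
proof -
  have fin: "finite I" and d3: "3 \<le> card I"
    and ind: "\<And>i j c. \<lbrakk>i \<in> I; j \<in> I; i \<noteq> j\<rbrakk> \<Longrightarrow> v i \<noteq> c *s v j"
    and conc: "\<And>n. n \<noteq> 0 \<Longrightarrow> 3 * card {i \<in> I. scalar_product (v i) n = 0} \<le> 2 * card I"
    using st unfolding semistable_def by blast+
  have "I \<noteq> {}" using d3 by auto
  with fin obtain i where i: "i \<in> I" "\<And>l. l \<in> I \<Longrightarrow> a i \<le> a l"
    by (rule ex_min_on[where a = a]) blast
  have "finite (I - {i})" using fin by simp
  moreover have "I - {i} \<noteq> {}" using d3 card_mono[of "{i}" I] by auto
  ultimately obtain j where j: "j \<in> I - {i}" "\<And>l. l \<in> I - {i} \<Longrightarrow> a j \<le> a l"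
    by (rule ex_min_on[where a = a]) blast
  define n where "n = ccross (v i) (v j)"
  have "n \<noteq> 0" unfolding n_def
    using i j st ind[of i j] by (intro ccross_nonzero) (auto dest: semistable_nonzero)
  define Z where "Z = {l \<in> I. scalar_product (v l) n = 0}"
  have Z: "3 * card Z \<le> 2 * card I" using conc[OF \<open>n \<noteq> 0\<close>] by (simp add: Z_def)
  have ZI: "Z \<subseteq> I" "finite Z" "i \<in> Z" "j \<in> Z" using i j fin by (auto simp: Z_def n_def)
  have "card Z < card I" using Z d3 by linarith
  then have "I - Z \<noteq> {}" using ZI by (metis card_mono Diff_eq_empty_iff leD)
  have "finite (I - Z)" using fin by simp
  from this \<open>I - Z \<noteq> {}\<close> obtain k where k: "k \<in> I - Z" "\<And>l. l \<in> I - Z \<Longrightarrow> a k \<le> a l"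
    by (rule ex_min_on[where a = a]) blast
  define m where "m = card (Z - {i})"
  have m: "card Z = Suc m" unfolding m_def by (rule card.remove) (use ZI in auto)
  have "card (I - Z) = card I - Suc m" using ZI fin m by (simp add: card_Diff_subset)
  then have r: "real (card (I - Z)) = real (card I) - 1 - real m"
    using \<open>card Z < card I\<close> m by simp
  have "real m * a j \<le> (\<Sum>l\<in>Z - {i}. a l)"
    unfolding m_def using sum_bounded_below[of "Z - {i}" "a j" a] j ZI by auto
  moreover have "real (card (I - Z)) * a k \<le> (\<Sum>l\<in>I - Z. a l)"
    using sum_bounded_below[of "I - Z" "a k" a] k by auto
  moreover have "(\<Sum>l\<in>I. a l) = a i + (\<Sum>l\<in>Z - {i}. a l) + (\<Sum>l\<in>I - Z. a l)"
    using sum.subset_diff[of Z I a] sum.remove[of Z i a] ZI fin by simp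
  ultimately have low: "a i + real m * a j + (real (card I) - 1 - real m) * a k \<le> (\<Sum>l\<in>I. a l)"
    unfolding r by linarith
  have ij: "0 \<le> a j - a i" and jk: "0 \<le> a k - a j" using i j k ZI by auto
  have md: "0 \<le> 2 * real (card I) - 3 - 3 * real m" and d3': "0 \<le> real (card I) - 3"
    using Z m d3 by linarith+
  \<comment> \<open>Summation by parts: the difference of the two sides of the next inequality is written in
    the nonnegative increments \<open>a k - a j\<close> and \<open>a j - a i\<close>.\<close>
  have "0 \<le> (2 * real (card I) - 3 - 3 * real m) * (a k - a j) + (real (card I) - 3) * (a j - a i)"
    using ij jk md d3' by simp
  then have "card I * (a i + a j + a k)
      \<le> 3 * (a i + real m * a j + (real (card I) - 1 - real m) * a k)"
    by (simp add: algebra_simps)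
  also have "\<dots> \<le> 3 * (\<Sum>l\<in>I. a l)" using low by simp
  finally have bound: "card I * (a i + a j + a k) \<le> 3 * (\<Sum>l\<in>I. a l)" .
  have nz: "det (vector [v i, v j, v k] :: complex ^ 3 ^ 3) \<noteq> 0"
    unfolding det_rows_eq_ccross n_def[symmetric] using k(1) by (simp add: Z_def)
  have jI: "j \<in> I" and kI: "k \<in> I" using j(1) k(1) by blast+
  show thesis by (rule that[OF i(1) jI kI nz bound])
qed

lemma det_nonzero_image_nonzero:
  fixes g :: "complex ^ 3 ^ 3"
  assumes "det g \<noteq> 0" "x \<noteq> 0"
  shows "g *v x \<noteq> 0"
  using assms by (metis invertible_det_nz invertible_left_inverse matrix_left_invertible_ker)

text \<open>
  The analytic form of semistability. For three independent vectors of the configuration,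
  \<open>det g\<close> is up to a constant the determinant of their images, hence at most a constant times the
  product of the norms of these images. Choosing the triple greedily for the weight
  \<open>ln |g v\<^sub>i|\<close> replaces that product by a power of the product over all of \<open>I\<close>. The constant is uniform
  in \<open>g\<close> because only finitely many triples occur.
\<close>

lemma semistable_log_det_bound:
  assumes st: "semistable I v"
  shows "\<exists>K. \<forall>g :: complex ^ 3 ^ 3. det g \<noteq> 0 \<longrightarrow>
           card I * ln (cmod (det g)) \<le> 3 * (\<Sum>i\<in>I. ln (norm (g *v v i))) + K"
proof -
  define D where "D i j k = det (vector [v i, v j, v k] :: complex ^ 3 ^ 3)" for i j k
  define V where "V = (\<lambda>(i, j, k). cmod (D i j k)) ` (I \<times> I \<times> I) - {0}"
  have "finite I" using st by (simp add: semistable_def)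
  then have "finite V" by (simp add: V_def)
  \<comment> \<open>The element \<open>1\<close> is inserted so that the minimum is over a nonempty set.\<close>
  define c where "c = Min (insert 1 V)"
  have "c \<in> insert 1 V" unfolding c_def using \<open>finite V\<close> by (intro Min_in) auto
  then have "c > 0" by (auto simp: V_def)
  have c_le: "c \<le> cmod (D i j k)" if "i \<in> I" "j \<in> I" "k \<in> I" "D i j k \<noteq> 0" for i j k
    unfolding c_def using \<open>finite V\<close> that by (intro Min_le) (force simp: V_def)+
  have "card I * ln (cmod (det g)) \<le> 3 * (\<Sum>i\<in>I. ln (norm (g *v v i))) + card I * ln (6 / c)"
    if g: "det g \<noteq> 0" for g :: "complex ^ 3 ^ 3"
  proof -
    define a where "a i = ln (norm (g *v v i))" for i
    have pos: "norm (g *v v i) > 0" if "i \<in> I" for i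
      using det_nonzero_image_nonzero[OF g semistable_nonzero[OF st that]] by simp
    obtain i j k where I: "i \<in> I" "j \<in> I" "k \<in> I"
      and nz: "det (vector [v i, v j, v k] :: complex ^ 3 ^ 3) \<noteq> 0"
      and bd: "card I * (a i + a j + a k) \<le> 3 * (\<Sum>l\<in>I. a l)"
      by (rule semistable_greedy_basis[OF st])
    have "cmod (det g) * c \<le> cmod (det g) * cmod (D i j k)"
      using c_le[OF I] nz by (intro mult_left_mono) (auto simp: D_def)
    also have "\<dots> = cmod (det (vector [g *v v i, g *v v j, g *v v k] :: complex ^ 3 ^ 3))"
      by (simp add: det_rows_image norm_mult D_def)
    also have "\<dots> \<le> 6 * (norm (g *v v i) * norm (g *v v j) * norm (g *v v k))"
      by (rule norm_det_rows_le)
    finally have "cmod (det g) \<le> 6 / c * (norm (g *v v i) * norm (g *v v j) * norm (g *v v k))"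
      using \<open>c > 0\<close> by (simp add: field_simps)
    then have "ln (cmod (det g))
        \<le> ln (6 / c * (norm (g *v v i) * norm (g *v v j) * norm (g *v v k)))"
      using g pos[OF I(1)] pos[OF I(2)] pos[OF I(3)] \<open>c > 0\<close> by (intro ln_mono) auto
    also have "\<dots> = ln (6 / c) + (a i + a j + a k)"
      unfolding a_def using pos[OF I(1)] pos[OF I(2)] pos[OF I(3)] \<open>c > 0\<close>
      by (subst ln_mult; simp)+
    finally have "card I * ln (cmod (det g)) \<le> card I * (ln (6 / c) + (a i + a j + a k))"
      by (intro mult_left_mono) auto
    also have "\<dots> = card I * (a i + a j + a k) + card I * ln (6 / c)"
      by (rule distrib_left[THEN trans]) (rule add.commute)
    also have "\<dots> \<le> 3 * (\<Sum>i\<in>I. a i) + card I * ln (6 / c)"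
      using bd by (rule add_right_mono)
    finally show ?thesis by (simp only: a_def)
  qed
  then show ?thesis by blast
qed

section \<open>A minimiser of the Kempf-Ness energy\<close>

text \<open>
  For \<open>e = 0\<close> this is the logarithmic Kempf-Ness function of the configuration, which is invariant
  under scaling of \<open>g\<close>. On a configuration that is semistable but not stable it need not attain its
  infimum. The terms with \<open>e > 0\<close> are again invariant under scaling, and they tend to infinity as a matrix
  of norm one degenerates; this forces a minimum.
\<close>

definition kn_energy :: "real \<Rightarrow> 'i set \<Rightarrow> ('i \<Rightarrow> complex ^ 3) \<Rightarrow> complex ^ 3 ^ 3 \<Rightarrow> real" where
  "kn_energy e I v g = 3 * (\<Sum>i\<in>I. ln (norm (g *v v i))) + 3 * e * ln (norm g)
     - (real (card I) + e) * ln (cmod (det g))"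

lemma det_scaleR_3: "det (c *\<^sub>R (g :: complex ^ 3 ^ 3)) = of_real c ^ 3 * det g"
proof -
  have "(c *\<^sub>R g) $ i $ j = of_real c * g $ i $ j" for i j
    by (simp add: scaleR_conv_of_real[of _ "g $ i $ j"])
  then show ?thesis by (simp only: det_3) (simp add: power3_eq_cube algebra_simps)
qed

lemma scaleR_matrix_vector_mult: "(c *\<^sub>R (g :: complex ^ 3 ^ 3)) *v x = c *\<^sub>R (g *v x)"
  by (simp add: vec_eq_iff matrix_vector_mult_def scaleR_sum_right)

lemma kn_energy_scaleR:
  assumes st: "semistable I v" and "c > 0" and g: "det g \<noteq> 0"
  shows "kn_energy e I v (c *\<^sub>R g) = kn_energy e I v g"
proof -
  have "g \<noteq> 0" using g by (auto simp: det_3)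
  have "ln (norm ((c *\<^sub>R g) *v v i)) = ln c + ln (norm (g *v v i))" if "i \<in> I" for i
    using det_nonzero_image_nonzero[OF g semistable_nonzero[OF st that]] \<open>c > 0\<close>
    by (simp add: scaleR_matrix_vector_mult ln_mult)
  then have "(\<Sum>i\<in>I. ln (norm ((c *\<^sub>R g) *v v i))) = card I * ln c + (\<Sum>i\<in>I. ln (norm (g *v v i)))"
    by (simp add: sum.distrib)
  moreover have "ln (norm (c *\<^sub>R g)) = ln c + ln (norm g)"
    using \<open>c > 0\<close> \<open>g \<noteq> 0\<close> by (simp add: ln_mult)
  moreover have "ln (cmod (det (c *\<^sub>R g))) = 3 * ln c + ln (cmod (det g))"
    using \<open>c > 0\<close> g by (simp add: det_scaleR_3 norm_mult norm_power ln_mult ln_realpow)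
  ultimately show ?thesis unfolding kn_energy_def by (simp only:) (simp add: algebra_simps)
qed

text \<open>
  By scale invariance only matrices of norm one matter. There the energy is at least
  \<open>- K - e ln |det g|\<close>, so that it exceeds its value at the identity wherever \<open>|det g|\<close> is smaller than a
  suitable \<open>\<eta>\<close>. What remains is a compact set on which the energy is continuous.
\<close>

lemma kn_energy_has_minimum:
  assumes st: "semistable I v" and e: "e > 0"
  obtains g where "det g \<noteq> 0" "\<And>h. det h \<noteq> 0 \<Longrightarrow> kn_energy e I v g \<le> kn_energy e I v h"
proof -
  obtain K where K: "\<And>g :: complex ^ 3 ^ 3. det g \<noteq> 0 \<Longrightarrow>
      card I * ln (cmod (det g)) \<le> 3 * (\<Sum>i\<in>I. ln (norm (g *v v i))) + K"
    using semistable_log_det_bound[OF st] by blast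
  define a where "a = kn_energy e I v (mat 1)"
  define \<eta> where "\<eta> = exp (- (a + K + 1) / e)"
  define G where "G = {g :: complex ^ 3 ^ 3. norm g = 1 \<and> \<eta> \<le> cmod (det g)}"
  have unit: "\<exists>g. norm g = 1 \<and> det g \<noteq> 0 \<and> kn_energy e I v g = kn_energy e I v h"
    if "det h \<noteq> 0" for h
  proof -
    have "h \<noteq> 0" using that by (auto simp: det_3)
    then show ?thesis
      using that kn_energy_scaleR[OF st, of "1 / norm h" h e]
      by (intro exI[of _ "(1 / norm h) *\<^sub>R h"]) (auto simp: det_scaleR_3)
  qed
  have large: "a < kn_energy e I v g" if "norm g = 1" "det g \<noteq> 0" "g \<notin> G" for g
  proof -
    have "ln (cmod (det g)) < ln \<eta>"
      using that by (intro ln_less_cancel_iff[THEN iffD2]) (auto simp: G_def \<eta>_def)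
    then have "e * ln (cmod (det g)) < - (a + K + 1)"
      using e by (simp add: \<eta>_def field_simps)
    then show ?thesis
      using K[OF that(2)] that(1) by (simp add: kn_energy_def algebra_simps)
  qed
  have det0: "det g \<noteq> 0" if "g \<in> G" for g
  proof -
    have "0 < \<eta>" by (simp add: \<eta>_def)
    with that show ?thesis by (auto simp: G_def)
  qed
  have cont_det: "continuous_on UNIV (det :: complex ^ 3 ^ 3 \<Rightarrow> complex)"
    unfolding det_3[abs_def] by (intro continuous_intros)
  have "G = sphere 0 1 \<inter> {g. \<eta> \<le> cmod (det g)}" by (auto simp: G_def)
  moreover have "closed {g :: complex ^ 3 ^ 3. \<eta> \<le> cmod (det g)}"
    by (intro closed_Collect_le continuous_intros cont_det)
  ultimately have "compact G" by (simp add: compact_Int_closed)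
  moreover have "continuous_on G (kn_energy e I v)"
  proof -
    have "continuous_on G (\<lambda>g. g *v x)" for x :: "complex ^ 3"
      unfolding matrix_vector_mult_def by (intro continuous_intros)
    moreover have "continuous_on G det"
      using cont_det by (rule continuous_on_subset) simp
    ultimately show ?thesis
      unfolding kn_energy_def[abs_def]
      using det0 det_nonzero_image_nonzero[OF det0 semistable_nonzero[OF st]]
      by (intro continuous_intros) (auto simp: G_def)
  qed
  moreover obtain g1 where g1: "norm g1 = 1" "det g1 \<noteq> 0" "kn_energy e I v g1 = a"
    using unit[of "mat 1"] by (auto simp: a_def)
  then have "g1 \<in> G" using large by force
  ultimately obtain g where g: "g \<in> G" "\<And>h. h \<in> G \<Longrightarrow> kn_energy e I v g \<le> kn_energy e I v h"
    using continuous_attains_inf[of G "kn_energy e I v"] by blast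
  show thesis
  proof (rule that)
    show "det g \<noteq> 0" using det0 g by blast
    fix h :: "complex ^ 3 ^ 3" assume "det h \<noteq> 0"
    then obtain h1 where h1: "norm h1 = 1" "det h1 \<noteq> 0" "kn_energy e I v h1 = kn_energy e I v h"
      using unit by blast
    show "kn_energy e I v g \<le> kn_energy e I v h"
      using g(2)[of h1] g(2)[OF \<open>g1 \<in> G\<close>] g1 h1 large[of h1] by (cases "h1 \<in> G") auto
  qed
qed

section \<open>The stationarity condition at the minimiser\<close>

lemma DERIV_ln_norm:
  fixes z :: "real \<Rightarrow> 'a::real_inner"
  assumes "(z has_vector_derivative z') (at 0)" "z 0 \<noteq> 0"
  shows "((\<lambda>s. ln (norm (z s))) has_real_derivative inner (z 0) z' / (norm (z 0))\<^sup>2) (at 0)"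
proof -
  have d: "(z has_derivative (\<lambda>s. s *\<^sub>R z')) (at 0)"
    using assms(1) by (simp add: has_vector_derivative_def)
  have "((\<lambda>s. norm (z s)) has_derivative (\<lambda>s. inner (s *\<^sub>R z') (sgn (z 0)))) (at 0)"
    by (rule has_derivative_compose[OF d has_derivative_norm]) (rule assms(2))
  then have "((\<lambda>s. norm (z s)) has_real_derivative inner (z 0) z' / norm (z 0)) (at 0)"
    unfolding has_field_derivative_def
    by (rule has_derivative_eq_rhs)
      (auto simp: sgn_div_norm inner_commute divide_inverse mult_ac)
  from DERIV_chain2[OF DERIV_ln this] assms(2) show ?thesis
    by (simp add: power2_eq_square divide_inverse mult_ac)
qed

lemma outer_scaleR: "outer (r *\<^sub>R w) = r\<^sup>2 *\<^sub>R outer w"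
  by (simp add: outer_def vec_eq_iff power2_eq_square)

lemma inner_matrix_matrix_mult:
  "inner g (S ** g) = (\<Sum>l\<in>UNIV. inner S (outer (column l g)))"
proof -
  have "inner g (S ** g) = (\<Sum>k\<in>UNIV. \<Sum>l\<in>UNIV. inner ((S *v column l g) $ k) (column l g $ k))"
    by (simp add: inner_vec_def matrix_matrix_mult_def matrix_vector_mult_def column_def inner_commute)
  also have "\<dots> = (\<Sum>l\<in>UNIV. \<Sum>k\<in>UNIV. inner ((S *v column l g) $ k) (column l g $ k))"
    by (rule sum.swap)
  also have "\<dots> = (\<Sum>l\<in>UNIV. inner (S *v column l g) (column l g))"
    by (simp add: inner_vec_def)
  finally show ?thesis by (simp add: inner_outer)
qed

lemma inner_mat_1: "inner (S :: complex ^ 3 ^ 3) (mat 1) = Re (S $ 1 $ 1 + S $ 2 $ 2 + S $ 3 $ 3)"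
proof -
  have "inner (S $ k $ l) (mat 1 $ k $ l) = (if l = k then Re (S $ k $ k) else 0)" for k l
    by (simp add: mat_def inner_complex_eq_Re)
  then have "inner S (mat 1) = (\<Sum>k\<in>UNIV. Re (S $ k $ k))" by (simp add: inner_vec_def)
  then show ?thesis by (simp add: sum_3)
qed

lemma det_derivative_at_1:
  fixes S :: "complex ^ 3 ^ 3"
  shows "((\<lambda>s. det (mat 1 + s *\<^sub>R S)) has_vector_derivative (S $ 1 $ 1 + S $ 2 $ 2 + S $ 3 $ 3)) (at 0)"
proof -
  define b where "b = S $ 1 $ 1 * S $ 2 $ 2 - S $ 1 $ 2 * S $ 2 $ 1 + S $ 1 $ 1 * S $ 3 $ 3
    - S $ 1 $ 3 * S $ 3 $ 1 + S $ 2 $ 2 * S $ 3 $ 3 - S $ 2 $ 3 * S $ 3 $ 2"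
  have m: "(mat 1 :: complex ^ 3 ^ 3) $ i $ j = (if i = j then 1 else 0)" for i j
    by (simp add: mat_def)
  have entry: "(mat 1 + s *\<^sub>R S) $ i $ j = (if i = j then 1 else 0) + of_real s * S $ i $ j" for s i j
    using scaleR_conv_of_real[of s "S $ i $ j"] m by simp
  have "det (mat 1 + s *\<^sub>R S)
      = 1 + of_real s * (S $ 1 $ 1 + S $ 2 $ 2 + S $ 3 $ 3) + of_real s ^ 2 * b + of_real s ^ 3 * det S" for s
    unfolding det_3 entry b_def by (simp add: power2_eq_square power3_eq_cube algebra_simps)
  then have "(\<lambda>s. det (mat 1 + s *\<^sub>R S)) = (\<lambda>s. 1 + s *\<^sub>R (S $ 1 $ 1 + S $ 2 $ 2 + S $ 3 $ 3)
      + s ^ 2 *\<^sub>R b + s ^ 3 *\<^sub>R det S)"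
    by (simp only: scaleR_conv_of_real of_real_power)
  then show ?thesis
    by (auto intro!: derivative_eq_intros simp: has_vector_derivative_def)
qed

text \<open>
  Move the minimiser \<open>g\<close> along \<open>s \<mapsto> (1 + s S) g\<close> with \<open>S = \<Sum>\<^sub>i u\<^sub>i u\<^sub>i\<^sup>*\<close>. The derivative of the energy at
  \<open>s = 0\<close> vanishes, and it equals \<open>3 |S|\<^sup>2 + 3 e \<langle>g, S g\<rangle> / |g|\<^sup>2 - (d + e) tr S\<close>. Here
  \<open>\<langle>g, S g\<rangle> \<ge> 0\<close> because \<open>S\<close> is positive semidefinite, \<open>tr S = d\<close> because the \<open>u\<^sub>i\<close> are unit vectors, and
  \<open>|S|\<^sup>2\<close> is the sum to be bounded. For \<open>e \<rightarrow> 0\<close> the vectors \<open>u\<^sub>i\<close> approach a tight frame, for which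
  this sum is \<open>d\<^sup>2 / 3\<close>. Taking \<open>S\<close> itself as the direction extracts the bound from a single derivative.
\<close>

lemma kn_minimum_frame_bound:
  fixes v :: "'i \<Rightarrow> complex ^ 3"
  assumes st: "semistable I v" and e: "e > 0" and g: "det g \<noteq> 0"
    and min: "\<And>h. det h \<noteq> 0 \<Longrightarrow> kn_energy e I v g \<le> kn_energy e I v h"
  defines "u \<equiv> \<lambda>i. (1 / norm (g *v v i)) *\<^sub>R (g *v v i)"
  shows "3 * (\<Sum>i\<in>I. \<Sum>j\<in>I. (cmod (herm (u i) (u j)))\<^sup>2) \<le> card I * (real (card I) + e)"
proof -
  define S where "S = (\<Sum>i\<in>I. outer (u i))"
  define h where "h s = (mat 1 + s *\<^sub>R S) ** g" for s :: real
  define t where "t = S $ 1 $ 1 + S $ 2 $ 2 + S $ 3 $ 3"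
  have "g \<noteq> 0" using g by (auto simp: det_3)
  have w0: "g *v v i \<noteq> 0" if "i \<in> I" for i
    using det_nonzero_image_nonzero[OF g semistable_nonzero[OF st that]] .
  have h_eq: "h s = g + s *\<^sub>R (S ** g)" for s
    by (simp add: h_def vec_eq_iff matrix_matrix_mult_def mat_def distrib_right sum.distrib
        scaleR_sum_right if_distrib[of "\<lambda>x. x * _"] cong: if_cong)
  have h_vec: "h s *v x = g *v x + s *\<^sub>R (S *v (g *v x))" for s x
    by (simp add: h_eq matrix_vector_mult_add_rdistrib scaleR_matrix_vector_mult matrix_vector_mul_assoc)
  have h0: "h 0 = g" by (simp add: h_eq)
  have dmat: "(h has_vector_derivative S ** g) (at 0)"
    unfolding h_eq[abs_def] by (auto intro!: derivative_eq_intros)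
  have dvec: "((\<lambda>s. h s *v x) has_vector_derivative S *v (g *v x)) (at 0)" for x
    unfolding h_vec by (auto intro!: derivative_eq_intros)
  have ddet: "((\<lambda>s. det (h s)) has_vector_derivative t * det g) (at 0)"
    unfolding h_def det_mul t_def
    by (rule has_vector_derivative_mult_left[OF det_derivative_at_1])
  have "((\<lambda>s. kn_energy e I v (h s)) has_real_derivative
      3 * (\<Sum>i\<in>I. inner (g *v v i) (S *v (g *v v i)) / (norm (g *v v i))\<^sup>2)
      + 3 * e * (inner g (S ** g) / (norm g)\<^sup>2)
      - (real (card I) + e) * (inner (det g) (t * det g) / (norm (det g))\<^sup>2)) (at 0)"
    unfolding kn_energy_def
    using DERIV_ln_norm[OF dmat] DERIV_ln_norm[OF ddet] DERIV_ln_norm[OF dvec] \<open>g \<noteq> 0\<close> g w0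
    by (intro DERIV_diff DERIV_add DERIV_cmult DERIV_sum) (simp_all add: h0)
  moreover have "inner (g *v v i) (S *v (g *v v i)) / (norm (g *v v i))\<^sup>2 = inner S (outer (u i))" for i
    by (simp add: u_def outer_scaleR inner_outer inner_commute power_divide)
  moreover have "inner (det g) (t * det g) / (norm (det g))\<^sup>2 = Re t"
  proof -
    have "inner (det g) (t * det g) = Re t * (cmod (det g))\<^sup>2"
      unfolding cmod_power2 by (simp add: inner_complex_def power2_eq_square algebra_simps)
    then show ?thesis using g by simp
  qed
  moreover have "Re t = card I"
  proof -
    have "Re t = inner S (mat 1)" by (simp add: inner_mat_1 t_def)
    also have "\<dots> = (\<Sum>i\<in>I. 1)"
      unfolding S_def inner_sum_left inner_outer_mat_1
      by (intro sum.cong) (use w0 in \<open>auto simp: u_def\<close>)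
    finally show ?thesis by simp
  qed
  moreover have "(\<Sum>i\<in>I. inner S (outer (u i))) = (\<Sum>i\<in>I. \<Sum>j\<in>I. (cmod (herm (u i) (u j)))\<^sup>2)"
    unfolding S_def inner_sum_left inner_outer_outer by (rule sum.swap)
  ultimately have deriv: "((\<lambda>s. kn_energy e I v (h s)) has_real_derivative
      3 * (\<Sum>i\<in>I. \<Sum>j\<in>I. (cmod (herm (u i) (u j)))\<^sup>2)
      + 3 * e * (inner g (S ** g) / (norm g)\<^sup>2) - (real (card I) + e) * card I) (at 0)"
    by simp
  have "isCont (\<lambda>s. det (h s)) 0"
    using ddet has_vector_derivative_continuous by blast
  then have "eventually (\<lambda>s. det (h s) \<noteq> 0) (at 0)"
    using g h0 tendsto_imp_eventually_ne[of "\<lambda>s. det (h s)" "det g" "at 0" 0]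
    by (simp add: isCont_def)
  then obtain r where r: "r > 0" "\<And>s. \<bar>s\<bar> < r \<Longrightarrow> s \<noteq> 0 \<Longrightarrow> det (h s) \<noteq> 0"
    by (auto simp: eventually_at dist_real_def)
  have "\<forall>s. \<bar>0 - s\<bar> < r \<longrightarrow> kn_energy e I v (h 0) \<le> kn_energy e I v (h s)"
    using r(2) min h0 by (metis abs_minus_commute diff_zero order_refl)
  from DERIV_local_min[OF deriv r(1) this]
  have "3 * (\<Sum>i\<in>I. \<Sum>j\<in>I. (cmod (herm (u i) (u j)))\<^sup>2)
      + 3 * e * (inner g (S ** g) / (norm g)\<^sup>2) = (real (card I) + e) * card I" by simp
  moreover have "0 \<le> inner g (S ** g)"
    unfolding inner_matrix_matrix_mult S_def inner_sum_left inner_outer_outer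
    by (intro sum_nonneg) simp
  ultimately show ?thesis using e by (smt (verit) divide_nonneg_nonneg mult.commute mult_nonneg_nonneg zero_le_power2)
qed

section \<open>The incidence inequality\<close>

text \<open>
  An ordered pair of distinct indices lies in at most one member of \<open>\<C>\<close>, so the off-diagonal sums over the
  members of \<open>\<C>\<close> are sums over disjoint sets of pairs.
\<close>

lemma sum_over_family_le:
  fixes f :: "'i \<Rightarrow> 'i \<Rightarrow> real"
  assumes "finite I" and CI: "\<And>C. C \<in> \<C> \<Longrightarrow> C \<subseteq> I"
    and meet: "\<And>C D. \<lbrakk>C \<in> \<C>; D \<in> \<C>; C \<noteq> D\<rbrakk> \<Longrightarrow> card (C \<inter> D) \<le> 1"
    and nonneg: "\<And>i j. 0 \<le> f i j"
  shows "(\<Sum>i\<in>I. f i i) + (\<Sum>C\<in>\<C>. (\<Sum>i\<in>C. \<Sum>j\<in>C. f i j) - (\<Sum>i\<in>C. f i i)) \<le> (\<Sum>i\<in>I. \<Sum>j\<in>I. f i j)"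
proof -
  define off where "off C = {(i, j). i \<in> C \<and> j \<in> C \<and> i \<noteq> j}" for C :: "'i set"
  let ?F = "\<lambda>(i, j). f i j"
  have offsub: "off C \<subseteq> C \<times> C" for C by (auto simp: off_def)
  have fC: "finite C" if "C \<in> \<C>" for C using that CI \<open>finite I\<close> finite_subset by blast
  have foff: "finite (off C)" if "finite C" for C
    using that offsub[of C] finite_subset finite_cartesian_product by blast
  have split: "(\<Sum>i\<in>C. \<Sum>j\<in>C. f i j) = sum ?F (off C) + (\<Sum>i\<in>C. f i i)" if "finite C" for C
  proof -
    have "C \<times> C = off C \<union> (\<lambda>i. (i, i)) ` C" by (auto simp: off_def)
    then have "sum ?F (C \<times> C) = sum ?F (off C) + sum ?F ((\<lambda>i. (i, i)) ` C)"
      using foff[OF that] that by (simp, subst sum.union_disjoint) (auto simp: off_def)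
    also have "sum ?F ((\<lambda>i. (i, i)) ` C) = (\<Sum>i\<in>C. f i i)"
      by (subst sum.reindex) (auto simp: inj_on_def)
    finally show ?thesis by (simp add: sum.cartesian_product)
  qed
  have "finite \<C>" using CI \<open>finite I\<close> by (meson Pow_iff finite_Pow_iff finite_subset subsetI)
  have disj: "off C \<inter> off D = {}" if "C \<in> \<C>" "D \<in> \<C>" "C \<noteq> D" for C D
  proof (rule ccontr)
    assume "off C \<inter> off D \<noteq> {}"
    then obtain i j where "{i, j} \<subseteq> C \<inter> D" "i \<noteq> j" by (auto simp: off_def)
    then have "2 \<le> card (C \<inter> D)" using fC[OF that(1)] card_mono[of "C \<inter> D" "{i, j}"] by auto
    then show False using meet[OF that] by simp
  qed
  have "(\<Sum>C\<in>\<C>. (\<Sum>i\<in>C. \<Sum>j\<in>C. f i j) - (\<Sum>i\<in>C. f i i)) = (\<Sum>C\<in>\<C>. sum ?F (off C))"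
    by (intro sum.cong) (auto simp: split fC)
  also have "\<dots> = sum ?F (\<Union>C\<in>\<C>. off C)"
    using \<open>finite \<C>\<close> fC foff disj by (intro sum.UNION_disjoint[symmetric]) auto
  also have "\<dots> \<le> sum ?F (off I)"
    using \<open>finite I\<close> foff CI nonneg by (intro sum_mono2) (auto simp: off_def)
  finally show ?thesis using split[OF \<open>finite I\<close>] by simp
qed

text \<open>
  Transform the configuration by a minimiser of the energy and normalise. The squared moduli
  of all the Hermitian products then add up to at most \<open>d (d + e) / 3\<close>. From below, the diagonal
  contributes \<open>d\<close>, and by the Welch bound the pairs of distinct indices in a collinear set of
  \<open>r\<close> vectors contribute at least \<open>r\<^sup>2 / 2 - r\<close>. Finally \<open>e\<close> tends to \<open>0\<close>.
\<close>

theorem semistable_incidence_bound: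
  fixes v :: "'i \<Rightarrow> complex ^ 3"
  assumes st: "semistable I v" and CI: "\<And>C. C \<in> \<C> \<Longrightarrow> C \<subseteq> I"
    and conc: "\<And>C. C \<in> \<C> \<Longrightarrow> \<exists>n. n \<noteq> 0 \<and> (\<forall>i\<in>C. scalar_product (v i) n = 0)"
    and meet: "\<And>C D. \<lbrakk>C \<in> \<C>; D \<in> \<C>; C \<noteq> D\<rbrakk> \<Longrightarrow> card (C \<inter> D) \<le> 1"
  shows "(\<Sum>C\<in>\<C>. (real (card C))\<^sup>2 / 2 - card C) \<le> card I * (real (card I) - 3) / 3"
proof -
  define X where "X = (\<Sum>C\<in>\<C>. (real (card C))\<^sup>2 / 2 - card C)"
  have "finite I" and d3: "3 \<le> card I" using st by (auto simp: semistable_def)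
  have "X \<le> card I * (real (card I) - 3) / 3 + \<delta>" if "\<delta> > 0" for \<delta>
  proof -
    define e where "e = 3 * \<delta> / card I"
    have "e > 0" using that d3 by (auto simp: e_def)
    then obtain g where g: "det g \<noteq> 0"
      and min: "\<And>h. det h \<noteq> 0 \<Longrightarrow> kn_energy e I v g \<le> kn_energy e I v h"
      using kn_energy_has_minimum[OF st] by blast
    define u where "u i = (1 / norm (g *v v i)) *\<^sub>R (g *v v i)" for i
    let ?f = "\<lambda>i j. (cmod (herm (u i) (u j)))\<^sup>2"
    have unit: "norm (u i) = 1" if "i \<in> I" for i
      using det_nonzero_image_nonzero[OF g semistable_nonzero[OF st that]] by (simp add: u_def)
    obtain g' where g': "g ** g' = mat 1" "g' ** g = mat 1"
      using g invertible_det_nz[of g] by (auto simp: invertible_def)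
    have welch: "(real (card C))\<^sup>2 / 2 \<le> (\<Sum>i\<in>C. \<Sum>j\<in>C. ?f i j)" if C: "C \<in> \<C>" for C
    proof -
      obtain n where n: "n \<noteq> 0" "\<And>i. i \<in> C \<Longrightarrow> scalar_product (v i) n = 0"
        using conc[OF C] by blast
      \<comment> \<open>Covectors transform by the inverse of \<open>g\<close>, so this one vanishes on the images of the
        vectors in \<open>C\<close>.\<close>
      define m where "m = n v* g'"
      have pair: "scalar_product (g *v x) m = scalar_product x n" for x
      proof -
        have "scalar_product (g *v x) m = scalar_product (g' *v (g *v x)) n"
          by (simp add: m_def scalar_product_def sum_3 vector_matrix_mult_def
              matrix_vector_mult_def algebra_simps)
        then show ?thesis by (simp add: matrix_vector_mul_assoc g')
      qed
      have "m \<noteq> 0"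
      proof
        assume "m = 0"
        then have "scalar_product x n = 0" for x using pair[of x] by (simp add: scalar_product_def)
        from this[of "axis k 1" for k] have "n = 0"
          by (simp add: vec_eq_iff scalar_product_def axis_def if_distrib[of "\<lambda>x. x * _"] cong: if_cong)
        with n show False by blast
      qed
      moreover have "scalar_product (u i) m = 0" if "i \<in> C" for i
      proof -
        have "scalar_product (u i) m = (1 / norm (g *v v i)) *\<^sub>R scalar_product (g *v v i) m"
          by (simp add: u_def scalar_product_def scaleR_sum_right)
        then show ?thesis using n(2)[OF that] by (simp add: pair)
      qed
      ultimately show ?thesis
        using unit CI[OF C] by (intro welch_bound_in_plane) auto
    qed
    have diag: "(\<Sum>i\<in>C. ?f i i) = card C" if "C \<subseteq> I" for C
    proof -
      have "(\<Sum>i\<in>C. ?f i i) = (\<Sum>i\<in>C. 1)"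
        using that unit by (intro sum.cong) (auto simp: herm_self)
      then show ?thesis by simp
    qed
    have "card I + X \<le> (\<Sum>i\<in>I. ?f i i) + (\<Sum>C\<in>\<C>. (\<Sum>i\<in>C. \<Sum>j\<in>C. ?f i j) - (\<Sum>i\<in>C. ?f i i))"
      unfolding X_def using welch CI by (simp add: diag) (auto intro!: sum_mono)
    also have "\<dots> \<le> (\<Sum>i\<in>I. \<Sum>j\<in>I. ?f i j)"
      using \<open>finite I\<close> CI meet by (intro sum_over_family_le) auto
    also have "\<dots> \<le> card I * (real (card I) + e) / 3"
      using kn_minimum_frame_bound[OF st \<open>e > 0\<close> g min] by (simp add: u_def)
    also have "\<dots> = (card I)\<^sup>2 / 3 + \<delta>"
      using d3 by (simp add: e_def field_simps power2_eq_square)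
    finally show ?thesis by (simp add: field_simps power2_eq_square)
  qed
  then show ?thesis unfolding X_def by (rule field_le_epsilon)
qed

section \<open>Line arrangements as point configurations\<close>

text \<open>
  The covector is the cross product of a basis of \<open>l\<close>; its kernel contains \<open>l\<close> and is a proper
  subspace, so it has no larger dimension.
\<close>

lemma proj_line_covector:
  assumes "l \<in> proj_lines"
  shows "\<exists>v. v \<noteq> 0 \<and> l = {x. scalar_product v x = 0}"
proof -
  have sub: "vec.subspace l" and dim: "vec.dim l = 2" using assms by (auto simp: proj_lines_def)
  obtain B where B: "B \<subseteq> l" "vec.independent B" "l \<subseteq> vec.span B" "card B = 2"
    using vec.basis_exists[of l] dim by metis
  then obtain a b where ab: "B = {a, b}" "a \<noteq> b" by (meson card_2_iff)
  define v where "v = ccross a b"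
  define k where "k = {x. scalar_product v x = 0}"
  have "b \<noteq> 0" using B(2) ab vec.dependent_zero by auto
  moreover have "a \<noteq> c *s b" for c
  proof
    assume "a = c *s b"
    then have "a \<in> vec.span {b}" by (metis vec.span_base vec.span_scale singletonI)
    then have "vec.dependent B"
      unfolding vec.dependent_def using ab by (metis insertI1 insert_Diff_if insert_iff Diff_insert_absorb singletonD)
    then show False using B(2) by blast
  qed
  ultimately have "v \<noteq> 0" unfolding v_def by (rule ccross_nonzero)
  have ksub: "vec.subspace k"
    by (auto simp: k_def vec.subspace_def scalar_product_def distrib_left sum.distrib
        mult.left_commute simp flip: sum_distrib_left)
  have "a \<in> k" "b \<in> k"
    using scalar_product_ccross(1)[of a b] scalar_product_ccross(2)[of b a] unfolding k_def v_def scalar_product_def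
    by (simp_all add: mult.commute[of "ccross a b $ _"])
  then have "l \<subseteq> k" using B(3) ab ksub vec.span_minimal[of B k] by auto
  have "k \<noteq> UNIV"
  proof
    assume "k = UNIV"
    then have "scalar_product v (axis i 1) = 0" for i by (auto simp: k_def)
    then have "v = 0"
      by (simp add: vec_eq_iff scalar_product_def axis_def if_distrib[of "\<lambda>x. _ * x"] cong: if_cong)
    with \<open>v \<noteq> 0\<close> show False by blast
  qed
  have dim3: "vec.dim (UNIV :: (complex ^ 3) set) = 3"
    unfolding vec_dim_card by simp
  then have "vec.dim k \<noteq> 3"
    using vec.subspace_dim_equal[OF ksub vec.subspace_UNIV] \<open>k \<noteq> UNIV\<close> by auto
  moreover have "vec.dim k \<le> 3"
    using vec.dim_subset[of k UNIV] dim3 by simp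
  ultimately have "vec.dim k \<le> vec.dim l" using dim by simp
  then have "l = k" using vec.subspace_dim_equal[OF sub ksub \<open>l \<subseteq> k\<close>] by simp
  then show ?thesis using \<open>v \<noteq> 0\<close> by (auto simp: k_def)
qed

lemma proj_points_eqI:
  assumes l: "l \<in> proj_lines" "m \<in> proj_lines" "l \<noteq> m"
    and p: "p \<in> proj_points" "q \<in> proj_points" "p \<subseteq> l" "p \<subseteq> m" "q \<subseteq> l" "q \<subseteq> m"
  shows "p = q"
proof -
  have sub: "vec.subspace (l \<inter> m)" using l by (auto simp: proj_lines_def vec.subspace_inter)
  have "vec.dim (l \<inter> m) \<le> 1"
  proof (rule ccontr)
    assume "\<not> vec.dim (l \<inter> m) \<le> 1"
    then have "vec.dim l \<le> vec.dim (l \<inter> m)" "vec.dim m \<le> vec.dim (l \<inter> m)"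
      using l by (simp_all add: proj_lines_def)
    then have "l \<inter> m = l" "l \<inter> m = m"
      using l vec.subspace_dim_equal[OF sub, of l] vec.subspace_dim_equal[OF sub, of m]
      unfolding proj_lines_def by blast+
    with \<open>l \<noteq> m\<close> show False by blast
  qed
  then have "p = l \<inter> m" "q = l \<inter> m"
    using p sub vec.subspace_dim_equal[of p "l \<inter> m"] vec.subspace_dim_equal[of q "l \<inter> m"]
    by (simp_all add: proj_points_def)
  then show ?thesis by simp
qed

text \<open>
  A point is determined by any two lines of \<open>L\<close> through it. This makes the pencils of lines through
  different points overlap in at most one line, and it identifies multiple points with their pencils.
\<close>

lemma lines_through_inj:
  assumes "L \<subseteq> proj_lines" "p \<in> proj_points" "q \<in> proj_points"
    and "2 \<le> card ({l \<in> L. p \<subseteq> l} \<inter> {l \<in> L. q \<subseteq> l})"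
  shows "p = q"
proof -
  obtain T where T: "T \<subseteq> {l \<in> L. p \<subseteq> l} \<inter> {l \<in> L. q \<subseteq> l}" "card T = 2"
    using assms(4) by (meson obtain_subset_with_card_n)
  then obtain l m where "T = {l, m}" "l \<noteq> m" by (meson card_2_iff)
  then have "l \<in> L" "m \<in> L" "p \<subseteq> l" "p \<subseteq> m" "q \<subseteq> l" "q \<subseteq> m"
    using T(1) by blast+
  then show ?thesis
    using proj_points_eqI[OF _ _ \<open>l \<noteq> m\<close> assms(2,3)] assms(1) by blast
qed

lemma inj_on_lines_through:
  assumes "L \<subseteq> proj_lines"
  shows "inj_on (\<lambda>p. {l \<in> L. p \<subseteq> l}) {p \<in> proj_points. 2 \<le> point_mult L p}"
proof (rule inj_onI)
  fix p q assume p: "p \<in> {p \<in> proj_points. 2 \<le> point_mult L p}"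
    and q: "q \<in> {p \<in> proj_points. 2 \<le> point_mult L p}"
    and eq: "{l \<in> L. p \<subseteq> l} = {l \<in> L. q \<subseteq> l}"
  have "2 \<le> card ({l \<in> L. p \<subseteq> l} \<inter> {l \<in> L. q \<subseteq> l})"
    unfolding eq Int_absorb using q by (simp only: point_mult_def mem_Collect_eq)
  moreover have "p \<in> proj_points" "q \<in> proj_points" using p q by simp_all
  ultimately show "p = q" by (intro lines_through_inj[OF assms])
qed

lemma finite_multiple_points:
  assumes "L \<subseteq> proj_lines" "finite L"
  shows "finite {p \<in> proj_points. 2 \<le> point_mult L p}"
proof (rule inj_on_finite[OF inj_on_lines_through[OF assms(1)]])
  show "(\<lambda>p. {l \<in> L. p \<subseteq> l}) ` {p \<in> proj_points. 2 \<le> point_mult L p} \<subseteq> Pow L" by blast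
  show "finite (Pow L)" using assms(2) by simp
qed

text \<open>
  The maximum in \<open>max_mult\<close> is over a bounded set of multiplicities, and every multiplicity that occurs
  belongs to it because \<open>n_mult\<close> counts a finite set of points.
\<close>

lemma point_mult_le_max_mult:
  assumes L: "L \<subseteq> proj_lines" "finite L" and p: "p \<in> proj_points" "2 \<le> point_mult L p"
  shows "point_mult L p \<le> max_mult L"
proof -
  have "finite {q \<in> proj_points. point_mult L q = point_mult L p}"
    by (rule finite_subset[OF _ finite_multiple_points[OF L]]) (use p in auto)
  then have pos: "n_mult L (point_mult L p) \<noteq> 0"
    using p by (auto simp: n_mult_def card_eq_0_iff)
  have "{r. 2 \<le> r \<and> n_mult L r \<noteq> 0} \<subseteq> {..card L}"
  proof clarsimp
    fix r assume "n_mult L r > 0"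
    then have "{q \<in> proj_points. point_mult L q = r} \<noteq> {}"
      unfolding n_mult_def by (metis card.empty less_irrefl)
    then obtain q where "point_mult L q = r" by blast
    then show "r \<le> card L" using L(2) by (auto simp: point_mult_def intro!: card_mono)
  qed
  then have "finite {r. 2 \<le> r \<and> n_mult L r \<noteq> 0}" using finite_subset by blast
  then show ?thesis unfolding max_mult_def using p pos by (intro Max_ge) auto
qed

theorem corollary3p2:
  fixes L :: "(complex ^ 3) set set" and d :: nat
  assumes "line_arrangement d L"
    and "d \<ge> 6"
    and "max_mult L = 4"
  shows "real (n_mult L 3) + 3 * real (n_mult L 4) \<le> 4 * real d * (real d - 3) / 15"
proof -
  have L: "L \<subseteq> proj_lines" "finite L" and d: "card L = d"
    using assms(1) by (auto simp: line_arrangement_def)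
  have le4: "point_mult L p \<le> 4" if "p \<in> proj_points" for p
    using point_mult_le_max_mult[OF L that] assms(3) by linarith
  obtain v where v: "\<And>l. l \<in> L \<Longrightarrow> v l \<noteq> 0" "\<And>l. l \<in> L \<Longrightarrow> l = {x. scalar_product (v l) x = 0}"
    using proj_line_covector L(1) by (metis subsetD)
  have on_line: "scalar_product (v l) x = 0 \<longleftrightarrow> x \<in> l" if "l \<in> L" for l x
    using v(2)[OF that] by blast
  \<comment> \<open>A nonzero \<open>n\<close> spans a point of the plane, and the covectors vanishing at \<open>n\<close> belong to the lines
    through that point; there are at most four of them, and \<open>3 * 4 \<le> 2 * d\<close> because \<open>d \<ge> 6\<close>.\<close>
  have st: "semistable L v"
    unfolding semistable_def
  proof (intro conjI ballI allI impI notI)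
    show "finite L" "3 \<le> card L" using L d assms(2) by auto
    fix l m c assume lm: "l \<in> L" "m \<in> L" "l \<noteq> m" "v l = c *s v m"
    then have "c \<noteq> 0" using v(1)[of l] by auto
    have "scalar_product (v l) x = c * scalar_product (v m) x" for x
      by (simp add: lm(4) scalar_product_def sum_distrib_left mult.assoc)
    then have "l = m" using v(2)[OF lm(1)] v(2)[OF lm(2)] \<open>c \<noteq> 0\<close> by simp
    with lm(3) show False ..
  next
    fix n :: "complex ^ 3" assume "n \<noteq> 0"
    define p where "p = vec.span {n}"
    have "p \<in> proj_points" using \<open>n \<noteq> 0\<close> by (simp add: p_def proj_points_def)
    moreover have "p \<subseteq> l \<longleftrightarrow> n \<in> l" if "l \<in> L" for l
      using that L(1) vec.span_minimal[of "{n}" l] vec.span_base[of n "{n}"]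
      by (auto simp: p_def proj_lines_def)
    then have "{l \<in> L. scalar_product (v l) n = 0} = {l \<in> L. p \<subseteq> l}" using on_line by blast
    ultimately show "3 * card {l \<in> L. scalar_product (v l) n = 0} \<le> 2 * card L"
      using le4[of p] assms(2) d by (simp add: point_mult_def)
  qed
  define P where "P r = {p \<in> proj_points. point_mult L p = r}" for r
  define lines where "lines p = {l \<in> L. p \<subseteq> l}" for p
  have fin: "finite (P 3)" "finite (P 4)"
    by (auto simp: P_def intro: finite_subset[OF _ finite_multiple_points[OF L]])
  have inj: "inj_on lines (P 3 \<union> P 4)"
    using inj_on_lines_through[OF L(1)] unfolding lines_def
    by (rule inj_on_subset) (auto simp: P_def)
  have "(\<Sum>C\<in>lines ` (P 3 \<union> P 4). (real (card C))\<^sup>2 / 2 - card C) \<le> card L * (real (card L) - 3) / 3"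
  proof (rule semistable_incidence_bound[OF st])
    fix C assume "C \<in> lines ` (P 3 \<union> P 4)"
    then obtain p where p: "p \<in> proj_points" "C = lines p" by (auto simp: P_def)
    then show "C \<subseteq> L" by (auto simp: lines_def)
    have "\<not> p \<subseteq> {0}" using p(1) vec.dim_subset[of p "{0}"] by (auto simp: proj_points_def)
    then obtain n where "n \<in> p" "n \<noteq> 0" by blast
    then show "\<exists>n. n \<noteq> 0 \<and> (\<forall>i\<in>C. scalar_product (v i) n = 0)"
      using p on_line by (auto simp: lines_def)
  next
    fix C D assume "C \<in> lines ` (P 3 \<union> P 4)" "D \<in> lines ` (P 3 \<union> P 4)" "C \<noteq> D"
    then obtain p q where "p \<in> proj_points" "q \<in> proj_points" "C = lines p" "D = lines q"
      by (auto simp: P_def)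
    then show "card (C \<inter> D) \<le> 1"
      using lines_through_inj[OF L(1), of p q] \<open>C \<noteq> D\<close> unfolding lines_def by fastforce
  qed
  also have "(\<Sum>C\<in>lines ` (P 3 \<union> P 4). (real (card C))\<^sup>2 / 2 - card C)
      = (\<Sum>p\<in>P 3 \<union> P 4. (real (point_mult L p))\<^sup>2 / 2 - point_mult L p)"
    unfolding sum.reindex[OF inj] by (simp add: point_mult_def lines_def)
  also have "\<dots> = (\<Sum>p\<in>P 3. (real (point_mult L p))\<^sup>2 / 2 - point_mult L p)
      + (\<Sum>p\<in>P 4. (real (point_mult L p))\<^sup>2 / 2 - point_mult L p)"
    using fin by (intro sum.union_disjoint) (auto simp: P_def)
  also have "\<dots> = 3 / 2 * n_mult L 3 + 4 * n_mult L 4"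
    by (simp add: P_def n_mult_def)
  finally have "3 / 2 * real (n_mult L 3) + 4 * n_mult L 4 \<le> d * (real d - 3) / 3"
    by (simp add: d)
  \<comment> \<open>Three quarters of the last inequality bound \<open>9 / 8 * n\<^sub>3 + 3 * n\<^sub>4\<close> by \<open>d (d - 3) / 4\<close>,
    and \<open>1 / 4 \<le> 4 / 15\<close>.\<close>
  moreover have "0 \<le> d * (real d - 3)" using assms(2) by simp
  ultimately show ?thesis by simp
qed

end
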